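(* Let $V$ be one of $\mathbb{R}^n$, $\mathbb{S}^n$ or $\mathbb{R}^{n\times N}$; in the last case assume $n\le N$. Suppose the convex function $f:V\to\mathbb{R}$ is $\mu$-sharp around $x^\natural\in V$ and $L$-Lipschitz in the $\ell_1$ norm. If $f$ is $\alpha$-sharp around $x^\natural$ and $\beta$-Lipschitz in the $\ell_2$ norm, then $\alpha$ and $\beta$ must satisfy $$\alpha\le L\qquad\text{and}\qquad\beta\ge\mu\sqrt n.$$
   Context: $\mathbb{S}^n$ is the space of real symmetric $n\times n$ matrices. For matrices, the "$\ell_p$ norm" means the Schatten-$p$ norm (the $\ell_p$ norm of the singular values); for vectors it is the usual $\ell_p$ norm. A convex $f:V\to\mathbb{R}$ is $\mu$-sharp ($\mu>0$) around $x^\natural$ in a norm $\|\cdot\|$ if $\arg\min f=\{x^\natural\}$ and $f(x)-f(x^\natural)\ge\mu\|x-x^\natural\|$ for all $x\in V$; it is $L$-Lipschitz in that norm if $|f(x)-f(y)|\le L\|x-y\|$ for all $x,y\in V$. *)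

theory Defs
  imports "HOL-Analysis.Analysis" "HOL-Computational_Algebra.Computational_Algebra"
begin

definition lp_norm :: "real \<Rightarrow> real ^ 'n \<Rightarrow> real" where
  "lp_norm p x = (\<Sum>i\<in>UNIV. \<bar>x $ i\<bar> powr p) powr (1 / p)"

definition charpoly :: "real ^ 'n ^ 'n \<Rightarrow> real poly" where
  "charpoly A = det (\<chi> i j. (if i = j then [:0, 1:] else 0) - [:A $ i $ j:])"

text \<open>
  The singular values, with multiplicity, of a matrix with rows indexed by \<open>'m\<close> and
  columns indexed by \<open>'n\<close>: the square roots of the eigenvalues of the smaller of its two
  Gram matrices, so that there are exactly \<open>min CARD('m) CARD('n)\<close> of them.
\<close>

definition singular_values :: "real ^ 'n ^ 'm \<Rightarrow> real multiset" where
  "singular_values A = image_mset sqrt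
     (if CARD('m) \<le> CARD('n) then proots (charpoly (A ** transpose A))
      else proots (charpoly (transpose A ** A)))"

definition schatten_norm :: "real \<Rightarrow> real ^ 'n ^ 'm \<Rightarrow> real" where
  "schatten_norm p A = (\<Sum>s\<in>#singular_values A. s powr p) powr (1 / p)"

definition symmetric_matrices :: "(real ^ 'n ^ 'n) set" where
  "symmetric_matrices = {A. transpose A = A}"

text \<open>
  Sharpness and Lipschitz continuity on a subspace \<open>V\<close>, with respect to a norm \<open>N\<close> that need not
  be the one of the type class; values of \<open>f\<close> outside \<open>V\<close> are irrelevant.
\<close>

definition sharp_around ::
  "'a::real_vector set \<Rightarrow> ('a \<Rightarrow> real) \<Rightarrow> ('a \<Rightarrow> real) \<Rightarrow> real \<Rightarrow> 'a \<Rightarrow> bool" where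
  "sharp_around V N f \<mu> x0 \<longleftrightarrow>
     \<mu> > 0 \<and> {x. is_arg_min f (\<lambda>y. y \<in> V) x} = {x0} \<and>
     (\<forall>x\<in>V. f x - f x0 \<ge> \<mu> * N (x - x0))"

definition lipschitz_wrt ::
  "'a::real_vector set \<Rightarrow> ('a \<Rightarrow> real) \<Rightarrow> ('a \<Rightarrow> real) \<Rightarrow> real \<Rightarrow> bool" where
  "lipschitz_wrt V N f L \<longleftrightarrow> (\<forall>x\<in>V. \<forall>y\<in>V. \<bar>f x - f y\<bar> \<le> L * N (x - y))"

end

theory Submission
  imports Defs
begin

text \<open>
  A function that is sharp in one norm and Lipschitz in another forces the two norms to be
  comparable: moving from \<open>x0\<close> by \<open>z\<close> raises \<open>f\<close> by at least \<open>\<alpha>\<close> times one norm of \<open>z\<close> and by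
  at most \<open>L\<close> times the other. Both bounds come from choosing \<open>z\<close> extremally for the
  comparison of \<open>\<ell>\<^sub>1\<close> with \<open>\<ell>\<^sub>2\<close>: a coordinate vector, where the two norms agree, gives
  \<open>\<alpha> \<le> L\<close>, and the all-ones vector, with norms \<open>n\<close> and \<open>sqrt n\<close>, gives \<open>\<mu> n \<le> \<beta> sqrt n\<close>.

  The matrix cases need no other test directions. Placing the coordinates of a vector on a (possibly
  partial) diagonal gives a matrix whose singular values are the absolute values of
  these coordinates (\<open>schatten_norm_generalized_diagonal\<close>). So each of the three spaces contains
  a copy of \<open>real ^ 'n\<close> on which its two norms are the \<open>\<ell>\<^sub>1\<close> and \<open>\<ell>\<^sub>2\<close> norms, and
  \<open>sharp_lipschitz_bounds_of_embedding\<close> treats them all at once.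
\<close>

section \<open>The extremal vectors\<close>

lemma lp_norm_axis: "lp_norm p (axis k 1 :: real ^ 'n) = 1"
proof -
  have "(\<Sum>i\<in>UNIV. \<bar>(axis k 1 :: real ^ 'n) $ i\<bar> powr p) = (\<Sum>i\<in>UNIV. if i = k then 1 else 0)"
    by (intro sum.cong) (auto simp: axis_def)
  then show ?thesis
    by (simp add: lp_norm_def)
qed

lemma lp_norm_ones: "lp_norm p (\<chi> i. 1 :: real ^ 'n) = real CARD('n) powr (1 / p)"
  by (simp add: lp_norm_def)

section \<open>Singular values of generalized diagonal matrices\<close>

text \<open>
  Rows and columns are indexed by unrelated types, so a rectangular matrix has no canonical
  diagonal; an injection \<open>g\<close> of the rows into the columns selects one. For a square matrix,
  \<open>g = id\<close> selects the usual diagonal.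
\<close>

definition generalized_diagonal :: "('n \<Rightarrow> 'N) \<Rightarrow> real ^ 'n \<Rightarrow> real ^ 'N ^ 'n" where
  "generalized_diagonal g c = (\<chi> i j. if j = g i then c $ i else 0)"

text \<open>
  Distinct rows have disjoint supports because \<open>g\<close> is injective, so they are orthogonal.
\<close>

lemma generalized_diagonal_gram:
  assumes "inj g"
  shows "generalized_diagonal g c ** transpose (generalized_diagonal g c)
    = (\<chi> i j. if i = j then (c $ i)\<^sup>2 else 0)"
proof -
  have "(\<Sum>k\<in>UNIV. (if k = g i then c $ i else 0) * (if k = g j then c $ j else 0))
      = (\<Sum>k\<in>UNIV. if k = g i then (if i = j then (c $ i)\<^sup>2 else 0) else 0)" for i j
    using injD[OF assms, of i j] by (intro sum.cong) (auto simp: power2_eq_square)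
  then show ?thesis
    by (simp add: vec_eq_iff matrix_matrix_mult_def transpose_def generalized_diagonal_def)
qed

lemma generalized_diagonal_id_symmetric: "generalized_diagonal id c \<in> symmetric_matrices"
  by (auto simp: symmetric_matrices_def generalized_diagonal_def transpose_def vec_eq_iff)

lemma charpoly_diagonal:
  "charpoly (\<chi> i j. if i = j then d i else 0) = (\<Prod>i\<in>UNIV. [:- d i, 1:])"
proof -
  have "charpoly (\<chi> i j. if i = j then d i else 0)
      = det (\<chi> i j. if i = j then [:- d i, 1:] else 0)"
    unfolding charpoly_def by (intro arg_cong[where f = det]) (simp add: vec_eq_iff)
  also have "\<dots> = (\<Prod>i\<in>UNIV. [:- d i, 1:])"
    by (subst det_diagonal) auto
  finally show ?thesis .
qed

lemma proots_prod_linear_factors: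
  "proots (\<Prod>i\<in>I. [:- d i, 1:]) = image_mset d (mset_set I)"
  for d :: "'i \<Rightarrow> 'a::idom"
proof -
  have "(\<Sum>i\<in>I. {#d i#}) = image_mset d (mset_set I)"
    by (induction I rule: infinite_finite_induct) auto
  then show ?thesis
    by (subst proots_prod) auto
qed

text \<open>
  The injection \<open>g\<close> shows that there are at most as many rows as columns. So the singular
  values are the square roots of the eigenvalues of the row Gram matrix, which is diagonal with
  entries \<open>(c $ i)\<^sup>2\<close>.
\<close>

lemma singular_values_generalized_diagonal:
  fixes g :: "'n::finite \<Rightarrow> 'N::finite"
  assumes "inj g"
  shows "singular_values (generalized_diagonal g c) = image_mset (\<lambda>i. \<bar>c $ i\<bar>) (mset_set UNIV)"
proof -
  have "CARD('n) \<le> CARD('N)"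
    using assms by (metis card_inj_on_le finite subset_UNIV)
  then show ?thesis
    by (simp add: singular_values_def generalized_diagonal_gram[OF assms] charpoly_diagonal
        proots_prod_linear_factors multiset.map_comp o_def)
qed

lemma schatten_norm_generalized_diagonal:
  "inj g \<Longrightarrow> schatten_norm p (generalized_diagonal g c) = lp_norm p c"
  by (simp add: schatten_norm_def singular_values_generalized_diagonal lp_norm_def
      multiset.map_comp o_def sum_unfold_sum_mset)

section \<open>Comparing sharpness and Lipschitz constants\<close>

text \<open>
  The increment \<open>f (x0 + z) - f x0\<close> lies between the two sides.
\<close>

lemma sharp_le_lipschitz:
  assumes "sharp_around V N f \<mu> x0" "lipschitz_wrt V M f L" "x0 \<in> V" "x0 + z \<in> V"
  shows "\<mu> * N z \<le> L * M z"
proof -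
  have "\<mu> * N z \<le> f (x0 + z) - f x0"
    using assms(1,4) by (force simp: sharp_around_def)
  also have "\<dots> \<le> L * M z"
    using assms(2-4) unfolding lipschitz_wrt_def by (metis abs_le_D1 add_diff_cancel_left')
  finally show ?thesis .
qed

text \<open>
  Pairing \<open>\<ell>\<^sub>2\<close>-sharpness with the \<open>\<ell>\<^sub>1\<close>-Lipschitz bound along a coordinate vector gives the first
  inequality; pairing \<open>\<ell>\<^sub>1\<close>-sharpness with the \<open>\<ell>\<^sub>2\<close>-Lipschitz bound along the all-ones vector gives
  the second.
\<close>

lemma sharp_lipschitz_bounds_of_embedding:
  fixes E :: "real ^ 'n \<Rightarrow> 'a::real_vector"
  assumes N1: "\<And>c. N1 (E c) = lp_norm 1 c" and N2: "\<And>c. N2 (E c) = lp_norm 2 c"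
    and V: "x0 \<in> V" "\<And>c. x0 + E c \<in> V"
    and l1: "sharp_around V N1 f \<mu> x0" "lipschitz_wrt V N1 f L"
    and l2: "sharp_around V N2 f \<alpha> x0" "lipschitz_wrt V N2 f \<beta>"
  shows "\<alpha> \<le> L \<and> \<beta> \<ge> \<mu> * sqrt (real CARD('n))"
proof
  \<comment> \<open>Any coordinate will do; \<open>undefined\<close> picks one of the nonempty index type.\<close>
  show "\<alpha> \<le> L"
    using sharp_le_lipschitz[OF l2(1) l1(2) V(1) V(2), of "axis undefined 1"]
    by (simp add: N1 N2 lp_norm_axis)
next
  have "\<mu> * real CARD('n) \<le> \<beta> * sqrt (real CARD('n))"
    using sharp_le_lipschitz[OF l1(1) l2(2) V(1) V(2), of "\<chi> i. 1"]
    by (simp add: N1 N2 lp_norm_ones powr_half_sqrt)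
  then have "(\<mu> * sqrt (real CARD('n))) * sqrt (real CARD('n)) \<le> \<beta> * sqrt (real CARD('n))"
    by (simp only: mult.assoc real_sqrt_mult_self abs_of_nat)
  then show "\<beta> \<ge> \<mu> * sqrt (real CARD('n))"
    by (rule mult_right_le_imp_le) simp
qed

theorem proposition4:
  fixes L \<mu> \<alpha> \<beta> :: real
  shows
    "(\<forall>(f :: real ^ 'n \<Rightarrow> real) x0.
        convex_on UNIV f \<and>
        sharp_around UNIV (lp_norm 1) f \<mu> x0 \<and> lipschitz_wrt UNIV (lp_norm 1) f L \<and>
        sharp_around UNIV (lp_norm 2) f \<alpha> x0 \<and> lipschitz_wrt UNIV (lp_norm 2) f \<beta>
        \<longrightarrow> \<alpha> \<le> L \<and> \<beta> \<ge> \<mu> * sqrt (real CARD('n))) \<and>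
     (\<forall>(f :: real ^ 'n ^ 'n \<Rightarrow> real) x0.
        x0 \<in> symmetric_matrices \<and> convex_on symmetric_matrices f \<and>
        sharp_around symmetric_matrices (schatten_norm 1) f \<mu> x0 \<and>
        lipschitz_wrt symmetric_matrices (schatten_norm 1) f L \<and>
        sharp_around symmetric_matrices (schatten_norm 2) f \<alpha> x0 \<and>
        lipschitz_wrt symmetric_matrices (schatten_norm 2) f \<beta>
        \<longrightarrow> \<alpha> \<le> L \<and> \<beta> \<ge> \<mu> * sqrt (real CARD('n))) \<and>
     (CARD('n) \<le> CARD('N) \<longrightarrow>
      (\<forall>(f :: real ^ 'N ^ 'n \<Rightarrow> real) x0.
        convex_on UNIV f \<and>
        sharp_around UNIV (schatten_norm 1) f \<mu> x0 \<and> lipschitz_wrt UNIV (schatten_norm 1) f L \<and>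
        sharp_around UNIV (schatten_norm 2) f \<alpha> x0 \<and> lipschitz_wrt UNIV (schatten_norm 2) f \<beta>
        \<longrightarrow> \<alpha> \<le> L \<and> \<beta> \<ge> \<mu> * sqrt (real CARD('n))))"
proof -
  have vectors: "\<alpha> \<le> L \<and> \<beta> \<ge> \<mu> * sqrt (real CARD('n))"
    if "sharp_around UNIV (lp_norm 1) f \<mu> x0" "lipschitz_wrt UNIV (lp_norm 1) f L"
      "sharp_around UNIV (lp_norm 2) f \<alpha> x0" "lipschitz_wrt UNIV (lp_norm 2) f \<beta>"
    for f :: "real ^ 'n \<Rightarrow> real" and x0
    by (rule sharp_lipschitz_bounds_of_embedding[OF _ _ _ _ that, where E = id]) auto
  have symmetric: "\<alpha> \<le> L \<and> \<beta> \<ge> \<mu> * sqrt (real CARD('n))"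
    if x0: "x0 \<in> symmetric_matrices"
      and f: "sharp_around symmetric_matrices (schatten_norm 1) f \<mu> x0"
      "lipschitz_wrt symmetric_matrices (schatten_norm 1) f L"
      "sharp_around symmetric_matrices (schatten_norm 2) f \<alpha> x0"
      "lipschitz_wrt symmetric_matrices (schatten_norm 2) f \<beta>"
    for f :: "real ^ 'n ^ 'n \<Rightarrow> real" and x0
  proof (rule sharp_lipschitz_bounds_of_embedding[OF _ _ x0 _ f])
    show "x0 + generalized_diagonal id c \<in> symmetric_matrices" for c
      using x0 generalized_diagonal_id_symmetric[of c]
      by (simp add: symmetric_matrices_def transpose_def vec_eq_iff)
  qed (simp_all add: schatten_norm_generalized_diagonal)
  have rectangular: "\<alpha> \<le> L \<and> \<beta> \<ge> \<mu> * sqrt (real CARD('n))"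
    if card: "CARD('n) \<le> CARD('N)"
      and f: "sharp_around UNIV (schatten_norm 1) f \<mu> x0"
      "lipschitz_wrt UNIV (schatten_norm 1) f L"
      "sharp_around UNIV (schatten_norm 2) f \<alpha> x0"
      "lipschitz_wrt UNIV (schatten_norm 2) f \<beta>"
    for f :: "real ^ 'N ^ 'n \<Rightarrow> real" and x0
  proof -
    obtain g :: "'n \<Rightarrow> 'N" where "inj g"
      using card card_le_inj[of "UNIV :: 'n set" "UNIV :: 'N set"] by auto
    then show ?thesis
      by (intro sharp_lipschitz_bounds_of_embedding[OF _ _ _ _ f, where E = "generalized_diagonal g"])
        (simp_all add: schatten_norm_generalized_diagonal)
  qed
  show ?thesis
    using vectors symmetric rectangular by blast
qed

end
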